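(* In the missing-at-random setting of the context, suppose $0<p_{A|X}(x)<1$ for all $x\in\mathcal X$, and let $\varepsilon>0$, $\alpha\in(0,1)$. Using the propensity-score $\varepsilon$-discretization $B_{1:n}$ and the bin notation of the context, define (when $N^{(0)}\ge1$) for all $x\in\mathcal X$ $$\hat C^{\mathrm{pro}}(x)=\Big\{y\in\mathcal Y:\ s(x,y)\le Q_{1-\alpha}\Big(\sum_{k=1}^M\sum_{i\in I_k^{\mathcal B,1}}\frac{N_k^{\mathcal B,0}}{N^{(0)}N_k^{\mathcal B}}\delta_{S_i}+\frac{1}{N^{(0)}}\sum_{k=1}^M\frac{(N_k^{\mathcal B,0})^2}{N_k^{\mathcal B}}\delta_{+\infty}\Big)\Big\}$$ (and $\hat C^{\mathrm{pro}}(x)=\mathcal Y$ if $N^{(0)}=0$). Then $$\mathbb E\Big[\frac{1}{N^{(0)}}\sum_{i\in I_{A=0}}\mathbf 1\{Y_i\in\hat C^{\mathrm{pro}}(X_i)\}\ \Big|\ B_{1:n},A_{1:n}\Big]\ge1-\alpha-\varepsilon.$$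
   Context: Missing-at-random setting: $\mathcal X\subset\mathbb R^d$, $\mathcal Y\subset\mathbb R$; $(X_i,Y_i,A_i)_{1\le i\le n}$ are i.i.d. with $X\sim P_X$, $Y\mid X\sim P_{Y|X}$, $A\mid X\sim\mathrm{Bernoulli}(p_{A|X}(X))$, $A$ and $Y$ conditionally independent given $X$; one observes $(X_i,A_i,Y_iA_i)$. $p_{A|X}(x)=\mathbb P(A=1\mid X=x)$. $I_{A=0}=\{i:A_i=0\}$, $N^{(0)}=|I_{A=0}|$. $s:\mathcal X\times\mathcal Y\to\mathbb R$ is a fixed measurable score (independent of the data), $S_i=s(X_i,Y_i)$. Propensity-score $\varepsilon$-discretization: for $k\in\mathbb Z$ let $z_k=(1+\varepsilon)^k/(1+(1+\varepsilon)^k)$ and $D_k=\{x: p_{A|X}(x)\in[z_k,z_{k+1})\}$ (so $(1+\varepsilon)^k\le p_{A|X}(x)/(1-p_{A|X}(x))<(1+\varepsilon)^{k+1}$ on $D_k$); $B_i$ is the unique $k$ with $X_i\in D_k$. Let $B'_1,\dots,B'_M$ be the distinct values among $B_1,\dots,B_n$; $I_k^{\mathcal B}=\{i:B_i=B'_k\}$, $I_k^{\mathcal B,0}=\{i\in I_k^{\mathcal B}:A_i=0\}$, $I_k^{\mathcal B,1}=\{i\in I_k^{\mathcal B}:A_i=1\}$, $N_k^{\mathcal B}=|I_k^{\mathcal B}|$, $N_k^{\mathcal B,0}=|I_k^{\mathcal B,0}|$. $Q_{1-\alpha}(P)=\inf\{t:\mathbb P_{T\sim P}(T\le t)\ge1-\alpha\}$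 for a distribution $P$ on $\mathbb R\cup\{+\infty\}$; $\delta_v$ is a point mass. The coverage proportion is defined as $1$ when $N^{(0)}=0$. *)

theory Defs
  imports "HOL-Probability.Probability"
begin

definition zgrid :: "real \<Rightarrow> int \<Rightarrow> real" where
  "zgrid eps k = (1 + eps) powr (real_of_int k) / (1 + (1 + eps) powr (real_of_int k))"

definition pbin :: "real \<Rightarrow> real \<Rightarrow> int" where
  "pbin eps t = (THE k. zgrid eps k \<le> t \<and> t < zgrid eps (k + 1))"

definition disc_quantile :: "real \<Rightarrow> 'i set \<Rightarrow> ('i \<Rightarrow> real) \<Rightarrow> ('i \<Rightarrow> ereal) \<Rightarrow> ereal" where
  "disc_quantile beta I w v = Inf {t. beta \<le> (\<Sum>i\<in>I. if v i \<le> t then w i else 0)}"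

text \<open>Counts. Samples are indexed by i < n; b i is the bin B_i, a i the indicator A_i.\<close>
definition N0 :: "nat \<Rightarrow> (nat \<Rightarrow> bool) \<Rightarrow> nat" where
  "N0 n a = card {i. i < n \<and> \<not> a i}"

definition NB :: "nat \<Rightarrow> (nat \<Rightarrow> int) \<Rightarrow> int \<Rightarrow> nat" where
  "NB n b k = card {i. i < n \<and> b i = k}"

definition NB0 :: "nat \<Rightarrow> (nat \<Rightarrow> int) \<Rightarrow> (nat \<Rightarrow> bool) \<Rightarrow> int \<Rightarrow> nat" where
  "NB0 n b a k = card {i. i < n \<and> b i = k \<and> \<not> a i}"

text \<open>The threshold Q_(1-alpha) of the weighted distribution in the definition of C^pro.
  Atom Some i (i < n, a i) sits at the score S i with weight N_k^(B,0)/(N^(0) N_k^B);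
  atom None sits at +infinity with weight (1/N^(0)) sum_k (N_k^(B,0))^2 / N_k^B, where the
  sum over k = 1..M is a sum over the distinct bin values b ` {..<n}.\<close>
definition pro_threshold ::
  "real \<Rightarrow> nat \<Rightarrow> (nat \<Rightarrow> int) \<Rightarrow> (nat \<Rightarrow> bool) \<Rightarrow> (nat \<Rightarrow> real) \<Rightarrow> ereal" where
  "pro_threshold alpha n b a S =
     disc_quantile (1 - alpha) (Some ` {i. i < n \<and> a i} \<union> {None})
       (\<lambda>j. case j of
              Some i \<Rightarrow> real (NB0 n b a (b i)) / (real (N0 n a) * real (NB n b (b i)))
            | None \<Rightarrow> (1 / real (N0 n a)) *
                  (\<Sum>k\<in>b ` {..<n}. real (NB0 n b a k) ^ 2 / real (NB n b k)))
       (\<lambda>j. case j of Some i \<Rightarrow> ereal (S i) | None \<Rightarrow> \<infinity>)"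

definition pro_coverage ::
  "real \<Rightarrow> real set \<Rightarrow> ('x \<Rightarrow> real \<Rightarrow> real) \<Rightarrow> nat \<Rightarrow> (nat \<Rightarrow> int) \<Rightarrow> (nat \<Rightarrow> bool)
     \<Rightarrow> (nat \<Rightarrow> 'x) \<Rightarrow> (nat \<Rightarrow> real) \<Rightarrow> real" where
  "pro_coverage alpha Ys s n b a x y =
     (if N0 n a = 0 then 1
      else (1 / real (N0 n a)) *
        (\<Sum>i\<in>{i. i < n \<and> \<not> a i}.
           if y i \<in> Ys \<and> ereal (s (x i) (y i)) \<le> pro_threshold alpha n b a (\<lambda>j. s (x j) (y j))
           then 1 else 0))"

end

theory Submission
  imports Defs
begin

text \<open>
  Moving the mass at infinity back to the unobserved scores only lowers the threshold, so it suffices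
  to bound the coverage of the quantile of the full weighted sample, whose weights are constant on
  bins and sum to 1. On the event of given bins and indicators, the law of the sample has a product
  density, with factors p (x l) or 1 - p (x l) according to the indicator of l, with respect to an i.i.d. law.
  Exchanging a missing index i with an index j of the same bin changes this density by a factor of at
  most 1 + eps, because the odds p / (1 - p) within a bin differ by at most that factor. Hence i is
  covered with at least 1 / (1 + eps) times the probability that j is. Averaging over j in the bin and
  summing over the missing i gives coverage at least (1 - alpha) / (1 + eps), which is at least
  1 - alpha - eps.
\<close>

section \<open>Propensity bins in terms of odds\<close>

text \<open>The grid point \<open>zgrid eps k\<close> is the probability with odds
  \<open>(1 + eps)\<close> to the power \<open>k\<close>, so taking logarithms turns the bin into a
  unit interval for the log odds. The floor also shows that the index in the definite description
  exists and is unique.\<close>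

lemma pbin_eq_floor_log:
  assumes "0 < eps" "0 < t" "t < 1"
  shows "pbin eps t = \<lfloor>log (1 + eps) (t / (1 - t))\<rfloor>"
proof -
  have odds: "(zgrid eps k \<le> t \<longleftrightarrow> real_of_int k \<le> log (1 + eps) (t / (1 - t)))" for k
  proof -
    have "zgrid eps k \<le> t \<longleftrightarrow> (1 + eps) powr k \<le> t / (1 - t)"
      using assms by (simp add: zgrid_def field_simps add_pos_pos)
    also have "\<dots> \<longleftrightarrow> real_of_int k \<le> log (1 + eps) (t / (1 - t))"
      using assms by (subst le_log_iff) auto
    finally show ?thesis .
  qed
  have "(zgrid eps k \<le> t \<and> t < zgrid eps (k + 1)) \<longleftrightarrow> k = \<lfloor>log (1 + eps) (t / (1 - t))\<rfloor>" for k
    using odds[of k] odds[of "k + 1"] by (auto simp: not_le[symmetric] floor_eq_iff) linarith+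
  then show ?thesis
    unfolding pbin_def by simp
qed

text \<open>Two log odds with the same floor differ by less than 1, so the odds differ by a factor
  below \<open>1 + eps\<close>. The conclusion is multiplied out because the densities are compared
  through such products.\<close>

lemma pbin_eq_imp_odds_le:
  assumes "0 < eps" "0 < t" "t < 1" "0 < u" "u < 1" "pbin eps t = pbin eps u"
  shows "(1 - u) * t \<le> (1 + eps) * ((1 - t) * u)"
proof -
  have "log (1 + eps) (t / (1 - t)) < log (1 + eps) (u / (1 - u)) + 1"
    using assms by (simp add: pbin_eq_floor_log) linarith
  also have "\<dots> = log (1 + eps) (u / (1 - u) * (1 + eps))"
    using assms by (subst log_mult) auto
  finally have "t / (1 - t) < u / (1 - u) * (1 + eps)"
    using assms by (subst (asm) log_less_cancel_iff) auto
  then show ?thesis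
    using assms by (simp add: field_simps)
qed

lemma pbin_measurable [measurable]:
  assumes "0 < eps" "p \<in> borel_measurable N" "\<And>x. x \<in> space N \<Longrightarrow> 0 < p x \<and> p x < 1"
  shows "(\<lambda>x. pbin eps (p x)) \<in> measurable N (count_space UNIV)"
proof -
  note [measurable] = assms(2)
  have "(\<lambda>x. \<lfloor>log (1 + eps) (p x / (1 - p x))\<rfloor>) \<in> measurable N (count_space UNIV)"
    by measurable
  then show ?thesis
    by (rule measurable_cong[THEN iffD1, rotated]) (use assms in \<open>simp add: pbin_eq_floor_log\<close>)
qed

section \<open>Weighted quantiles and bin averages\<close>

text \<open>This replaces the infimum by a finite sum. If the mass strictly below \<open>x\<close>
  already reaches \<open>beta\<close>, it sits on finitely many values, and the largest of them,
  \<open>Max V\<close>, belongs to the set of the infimum although it is below \<open>x\<close>.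
  Positivity of \<open>beta\<close> makes \<open>V\<close> nonempty.\<close>

lemma ereal_le_disc_quantile_iff:
  assumes "finite I" "\<And>i. i \<in> I \<Longrightarrow> 0 \<le> w i" "0 < beta"
  shows "ereal x \<le> disc_quantile beta I w v \<longleftrightarrow> (\<Sum>i\<in>I. if v i < ereal x then w i else 0) < beta"
proof
  assume le: "ereal x \<le> disc_quantile beta I w v"
  show "(\<Sum>i\<in>I. if v i < ereal x then w i else 0) < beta"
  proof (rule ccontr)
    assume *: "\<not> ?thesis"
    define V where "V = v ` {i \<in> I. v i < ereal x}"
    have V: "finite V"
      using assms by (simp add: V_def)
    have "V \<noteq> {}"
    proof
      assume "V = {}"
      then have "(\<Sum>i\<in>I. if v i < ereal x then w i else 0) = 0"
        by (intro sum.neutral) (auto simp: V_def)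
      then show False using * assms by simp
    qed
    have "Max V < ereal x"
      using Max_in[OF V \<open>V \<noteq> {}\<close>] by (auto simp: V_def)
    have "(\<Sum>i\<in>I. if v i < ereal x then w i else 0) \<le> (\<Sum>i\<in>I. if v i \<le> Max V then w i else 0)"
      using assms V by (intro sum_mono) (auto simp: V_def intro: Max_ge)
    then have "disc_quantile beta I w v \<le> Max V"
      unfolding disc_quantile_def using * by (intro Inf_lower) auto
    then show False
      using le \<open>Max V < ereal x\<close> by auto
  qed
next
  assume less: "(\<Sum>i\<in>I. if v i < ereal x then w i else 0) < beta"
  show "ereal x \<le> disc_quantile beta I w v"
    unfolding disc_quantile_def
  proof (rule Inf_greatest, rule ccontr)
    fix t assume t: "t \<in> {t. beta \<le> (\<Sum>i\<in>I. if v i \<le> t then w i else 0)}" "\<not> ereal x \<le> t"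
    have "(\<Sum>i\<in>I. if v i \<le> t then w i else 0) \<le> (\<Sum>i\<in>I. if v i < ereal x then w i else 0)"
      using assms t by (intro sum_mono) auto
    then show False
      using less t by auto
  qed
qed

text \<open>The selected indices are those whose value does not exceed the
  \<open>beta\<close>-quantile. If some index is not selected, take one, \<open>m\<close>, with the
  least value: everything strictly below it is selected, and its failure says precisely that this
  part weighs at least \<open>beta\<close>.\<close>

lemma sum_weights_below_quantile:
  fixes w :: "'i \<Rightarrow> real" and v :: "'i \<Rightarrow> 'b::linorder"
  assumes "finite I" "\<And>i. i \<in> I \<Longrightarrow> 0 \<le> w i" "beta \<le> sum w I"
  shows "beta \<le> (\<Sum>j\<in>I. if (\<Sum>i\<in>I. if v i < v j then w i else 0) < beta then w j else 0)"
proof -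
  define G where "G j \<longleftrightarrow> (\<Sum>i\<in>I. if v i < v j then w i else 0) < beta" for j
  show ?thesis
  proof (cases "\<forall>j\<in>I. G j")
    case True
    then show ?thesis using assms by (simp add: G_def)
  next
    case False
    define m where "m = arg_min_on v {j \<in> I. \<not> G j}"
    have fin: "finite {j \<in> I. \<not> G j}" "{j \<in> I. \<not> G j} \<noteq> {}"
      using False assms by auto
    have m: "m \<in> I" "\<not> G m" "\<And>i. i \<in> I \<Longrightarrow> v i < v m \<Longrightarrow> G i"
      using arg_min_if_finite[OF fin, of v] by (auto simp: m_def)
    have "beta \<le> (\<Sum>i\<in>I. if v i < v m then w i else 0)"
      using m(2) by (simp add: G_def)
    also have "\<dots> \<le> (\<Sum>j\<in>I. if G j then w j else 0)"
      using assms m(3) by (intro sum_mono) auto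
    finally show ?thesis by (simp add: G_def)
  qed
qed

text \<open>Double counting of pairs of a missing \<open>i\<close> and a \<open>j\<close> in its
  bin: each \<open>j\<close> is met once for every missing index of its own bin.\<close>

lemma sum_bin_averages:
  fixes e :: "nat \<Rightarrow> real"
  shows "(\<Sum>j<n. real (NB0 n b a (b j)) / real (NB n b (b j)) * e j)
       = (\<Sum>i | i < n \<and> \<not> a i. (\<Sum>j | j < n \<and> b j = b i. e j) / real (NB n b (b i)))"
proof -
  have "(\<Sum>i | i < n \<and> \<not> a i. (\<Sum>j | j < n \<and> b j = b i. e j) / real (NB n b (b i)))
      = (\<Sum>i | i < n \<and> \<not> a i. \<Sum>j<n. if b j = b i then e j / real (NB n b (b j)) else 0)"
    by (intro sum.cong refl)
       (auto simp: sum_divide_distrib sum.If_cases Int_def intro!: sum.cong)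
  also have "\<dots> = (\<Sum>j<n. \<Sum>i | i < n \<and> \<not> a i. if b j = b i then e j / real (NB n b (b j)) else 0)"
    by (rule sum.swap)
  also have "\<dots> = (\<Sum>j<n. real (NB0 n b a (b j)) / real (NB n b (b j)) * e j)"
  proof (intro sum.cong refl)
    fix j
    have "(\<Sum>i | i < n \<and> \<not> a i. if b j = b i then e j / real (NB n b (b j)) else 0)
        = (\<Sum>i | i < n \<and> b i = b j \<and> \<not> a i. e j / real (NB n b (b j)))"
      by (intro sum.mono_neutral_cong_right) auto
    then show "(\<Sum>i | i < n \<and> \<not> a i. if b j = b i then e j / real (NB n b (b j)) else 0)
        = real (NB0 n b a (b j)) / real (NB n b (b j)) * e j"
      by (simp add: NB0_def)
  qed
  finally show ?thesis by simp
qed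

section \<open>Conditioning on a discrete variable, and exchangeability of product measures\<close>

text \<open>The conditional expectation is constant on each level set of \<open>T\<close>, so a
  bound on its integrals over level sets is a bound on its values, except on level sets of
  probability 0. Countability of the type of \<open>T\<close> merges the exceptional sets.\<close>

lemma (in prob_space) real_cond_exp_discrete_ge:
  fixes T :: "'a \<Rightarrow> 't::countable"
  assumes T [measurable]: "T \<in> measurable M (count_space UNIV)"
    and f: "integrable M f"
    and ge: "\<And>t. c * prob {\<omega> \<in> space M. T \<omega> = t} \<le> (\<integral>\<omega>. indicator {\<omega> \<in> space M. T \<omega> = t} \<omega> * f \<omega> \<partial>M)"
  shows "AE \<omega> in M. c \<le> real_cond_exp M (vimage_algebra (space M) T (count_space UNIV)) f \<omega>"
proof -
  define F where "F = vimage_algebra (space M) T (count_space UNIV)"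
  have sub: "subalgebra M F"
    using T unfolding subalgebra_def F_def by (auto simp: sets_vimage_algebra2 intro: measurable_sets)
  interpret sigma_finite_subalgebra M F
    using sub by (intro finite_measure_subalgebra_is_sigma_finite)
       (simp add: finite_measure_subalgebra_def finite_measure_subalgebra_axioms_def finite_measure_axioms)
  define h where "h = real_cond_exp M F f"
  have h: "h \<in> borel_measurable F" "integrable M h"
    using f by (auto simp: h_def real_cond_exp_int)
  have [measurable]: "h \<in> borel_measurable M"
    using h by simp
  \<comment> \<open>A level set of \<open>h\<close> lies in \<open>F\<close>, hence is a preimage
    under \<open>T\<close>, and so contains with a point every other point having the same value of
    \<open>T\<close>.\<close>
  have const: "h \<omega> = h \<omega>'" if "\<omega> \<in> space M" "\<omega>' \<in> space M" "T \<omega> = T \<omega>'" for \<omega> \<omega>'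
  proof -
    have "h -` {h \<omega>} \<inter> space F \<in> sets F"
      by (rule measurable_sets[OF h(1)]) simp
    then obtain L where L: "h -` {h \<omega>} \<inter> space M = T -` L \<inter> space M"
      unfolding F_def by (subst (asm) sets_vimage_algebra2) (simp_all, metis)
    have "\<omega> \<in> h -` {h \<omega>} \<inter> space M" using that by simp
    then have "\<omega>' \<in> T -` L \<inter> space M"
      using that by (simp only: L) simp
    then show ?thesis by (simp only: L[symmetric]) simp
  qed
  have "AE \<omega> in M. T \<omega> = t \<longrightarrow> c \<le> h \<omega>" for t
  proof (cases "\<exists>\<omega>0 \<in> space M. T \<omega>0 = t \<and> h \<omega>0 < c")
    case True
    then obtain \<omega>0 where w0: "\<omega>0 \<in> space M" "T \<omega>0 = t" "h \<omega>0 < c" by blast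
    let ?G = "{\<omega> \<in> space M. T \<omega> = t}"
    have "?G = T -` {t} \<inter> space M" by auto
    then have GF: "?G \<in> sets F"
      by (simp only: F_def) (rule in_vimage_algebra, simp)
    have "c * prob ?G \<le> (\<integral>\<omega>. indicator ?G \<omega> * f \<omega> \<partial>M)"
      by (rule ge)
    also have "\<dots> = (\<integral>\<omega>. indicator ?G \<omega> * h \<omega> \<partial>M)"
      using real_cond_exp_intA[OF f GF] unfolding h_def set_lebesgue_integral_def real_scaleR_def .
    also have "\<dots> = (\<integral>\<omega>. indicator ?G \<omega> * h \<omega>0 \<partial>M)"
    proof (rule Bochner_Integration.integral_cong[OF refl])
      fix \<omega> assume "\<omega> \<in> space M"
      then show "indicator ?G \<omega> * h \<omega> = indicator ?G \<omega> * h \<omega>0"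
        using const[of \<omega> \<omega>0] w0 by (simp add: indicator_def)
    qed
    also have "\<dots> = h \<omega>0 * prob ?G"
      by (simp add: Int_absorb1)
    \<comment> \<open>Here \<open>c * prob ?G\<close> is at most
      \<open>h \<omega>0 * prob ?G\<close> while \<open>h \<omega>0 < c\<close>, which only a null
      set allows.\<close>
    finally have "prob ?G = 0"
      using w0(3) measure_nonneg[of M ?G] by (auto simp: mult_le_cancel_right)
    then have "AE \<omega> in M. \<omega> \<notin> ?G"
      by (subst (asm) prob_eq_0) auto
    with AE_space show ?thesis by eventually_elim auto
  next
    case False
    then show ?thesis by (intro AE_I2) (auto simp: not_less)
  qed
  then have "AE \<omega> in M. \<forall>t. T \<omega> = t \<longrightarrow> c \<le> h \<omega>"
    by (subst AE_all_countable) blast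
  then show ?thesis by (simp add: h_def F_def)
qed

text \<open>All factors are equal, so permuting the coordinates preserves the product
  measure.\<close>

lemma (in prob_space) nn_integral_PiM_transpose:
  assumes "i \<in> I" "j \<in> I" "f \<in> borel_measurable (PiM I (\<lambda>_. M))"
  shows "(\<integral>\<^sup>+z. f z \<partial>PiM I (\<lambda>_. M)) = (\<integral>\<^sup>+z. f (\<lambda>l\<in>I. z (Transposition.transpose i j l)) \<partial>PiM I (\<lambda>_. M))"
proof -
  let ?t = "\<lambda>z. \<lambda>l\<in>I. z (Transposition.transpose i j l)"
  have tI: "Transposition.transpose i j l \<in> I" if "l \<in> I" for l
    using assms that by (auto simp: Transposition.transpose_def)
  have "distr (PiM I (\<lambda>_. M)) (PiM I (\<lambda>_. M)) ?t = PiM I (\<lambda>_. M)"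
    by (rule distr_PiM_reindex) (use tI prob_space_axioms in \<open>auto intro: inj_on_subset[OF inj_transpose]\<close>)
  moreover have "?t \<in> measurable (PiM I (\<lambda>_. M)) (PiM I (\<lambda>_. M))"
    by (rule measurable_restrict) (use tI in measurable)
  ultimately show ?thesis
    using assms(3) by (metis nn_integral_distr)
qed

section \<open>The law of the sample on an event of fixed bins and indicators\<close>

text \<open>\<open>A_law\<close> states that the conditional probability of \<open>A i\<close> given
  both \<open>X i\<close> and \<open>Y i\<close> is \<open>p (X i)\<close>; this carries the
  Bernoulli law and the conditional independence of \<open>A\<close> and \<open>Y\<close> given
  \<open>X\<close> at once.\<close>

locale mar_sample = prob_space M for M :: "'w measure" +
  fixes SX :: "'x measure" and X :: "nat \<Rightarrow> 'w \<Rightarrow> 'x" and Y :: "nat \<Rightarrow> 'w \<Rightarrow> real"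
    and A :: "nat \<Rightarrow> 'w \<Rightarrow> bool" and p :: "'x \<Rightarrow> real" and n :: nat and eps :: real
  assumes iid_indep: "indep_vars (\<lambda>_. SX \<Otimes>\<^sub>M borel \<Otimes>\<^sub>M count_space UNIV)
                     (\<lambda>i \<omega>. (X i \<omega>, Y i \<omega>, A i \<omega>)) {..<n}"
    and iid_ident: "\<And>i. i < n \<Longrightarrow>
          distr M (SX \<Otimes>\<^sub>M borel) (\<lambda>\<omega>. (X i \<omega>, Y i \<omega>)) = distr M (SX \<Otimes>\<^sub>M borel) (\<lambda>\<omega>. (X 0 \<omega>, Y 0 \<omega>))"
    and A_law: "\<And>i S a. i < n \<Longrightarrow> S \<in> sets (SX \<Otimes>\<^sub>M borel) \<Longrightarrow>
          measure M {\<omega> \<in> space M. (X i \<omega>, Y i \<omega>) \<in> S \<and> A i \<omega> = a}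
          = (\<integral>\<omega>. indicator S (X i \<omega>, Y i \<omega>) * (if a then p (X i \<omega>) else 1 - p (X i \<omega>)) \<partial>M)"
    and p_meas [measurable]: "p \<in> borel_measurable SX"
    and p_bounds: "\<And>x. x \<in> space SX \<Longrightarrow> 0 < p x \<and> p x < 1"
    and eps: "0 < eps"
begin

abbreviation "N \<equiv> SX \<Otimes>\<^sub>M (borel :: real measure)"
abbreviation "NN \<equiv> PiM {..<n} (\<lambda>_. N)"

definition "P = distr M N (\<lambda>\<omega>. (X 0 \<omega>, Y 0 \<omega>))"
definition "bin x = pbin eps (p x)"
definition "sample \<omega> = (\<lambda>l\<in>{..<n}. (X l \<omega>, Y l \<omega>))"

text \<open>One outcome of the conditioning variables. On it the weights in the quantile are
  constants.\<close>

definition "bin_event b a = {\<omega> \<in> space M. \<forall>l<n. bin (X l \<omega>) = b l \<and> A l \<omega> = a l}"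

text \<open>The density factor of coordinate \<open>l\<close>: the conditional probability, given
  that its covariate and response are \<open>z\<close>, of the bin \<open>b l\<close> together with
  the indicator \<open>a l\<close>.\<close>

definition "wt b a l z = ennreal (if bin (fst z) = b l then (if a l then p (fst z) else 1 - p (fst z)) else 0)"
  for b :: "nat \<Rightarrow> int" and a :: "nat \<Rightarrow> bool" and l and z :: "'x \<times> real"

lemma sample_measurable [measurable]:
  assumes "l < n"
  shows "X l \<in> measurable M SX" "Y l \<in> borel_measurable M" "A l \<in> measurable M (count_space UNIV)"
proof -
  have *: "(\<lambda>\<omega>. (X l \<omega>, Y l \<omega>, A l \<omega>)) \<in> measurable M (SX \<Otimes>\<^sub>M borel \<Otimes>\<^sub>M count_space UNIV)"
    using iid_indep assms by (auto simp: indep_vars_def)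
  show "X l \<in> measurable M SX" "Y l \<in> borel_measurable M" "A l \<in> measurable M (count_space UNIV)"
    using measurable_compose[OF * measurable_fst]
      measurable_compose[OF measurable_compose[OF * measurable_snd] measurable_fst]
      measurable_compose[OF measurable_compose[OF * measurable_snd] measurable_snd]
    by simp_all
qed

lemma X_in_space: "l < n \<Longrightarrow> \<omega> \<in> space M \<Longrightarrow> X l \<omega> \<in> space SX"
  using measurable_space[OF sample_measurable(1)] .

lemma sample_meas [measurable]: "sample \<in> measurable M NN"
  unfolding sample_def[abs_def] by (rule measurable_restrict) (simp add: sample_measurable)

lemma bin_measurable [measurable]: "bin \<in> measurable SX (count_space UNIV)"
  unfolding bin_def[abs_def] using eps p_meas p_bounds by (rule pbin_measurable)

lemma wt_measurable [measurable]: "wt b a l \<in> borel_measurable N"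
  unfolding wt_def[abs_def] by measurable

lemma bin_event_sets [measurable]: "bin_event b a \<in> sets M"
proof -
  have "bin_event b a = {\<omega> \<in> space M. \<forall>l\<in>{..<n}. bin (X l \<omega>) = b l \<and> A l \<omega> = a l}"
    by (auto simp: bin_event_def)
  also have "\<dots> \<in> sets M"
  proof (rule sets.sets_Collect_finite_All)
    fix l assume "l \<in> {..<n}"
    then have [measurable]: "X l \<in> measurable M SX" "A l \<in> measurable M (count_space UNIV)"
      using sample_measurable by auto
    show "{\<omega> \<in> space M. bin (X l \<omega>) = b l \<and> A l \<omega> = a l} \<in> sets M" by measurable
  next
    show "finite {..<n}" by simp
  qed
  finally show ?thesis .
qed

lemma emeasure_single:
  assumes l: "l < n" and E [measurable]: "E \<in> sets N"
  shows "emeasure M {\<omega> \<in> space M. (X l \<omega>, Y l \<omega>) \<in> E \<and> bin (X l \<omega>) = b l \<and> A l \<omega> = a l}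
       = (\<integral>\<^sup>+z. wt b a l z * indicator E z \<partial>P)"
proof -
  note [measurable] = sample_measurable[OF l]
  \<comment> \<open>Absorbing the bin condition into the set leaves an event of the shape treated by
    \<open>A_law\<close>.\<close>
  define S where "S = {z \<in> space N. z \<in> E \<and> bin (fst z) = b l}"
  have S [measurable]: "S \<in> sets N" unfolding S_def by measurable
  let ?q = "\<lambda>x. if a l then p x else 1 - p x"
  have "{\<omega> \<in> space M. (X l \<omega>, Y l \<omega>) \<in> E \<and> bin (X l \<omega>) = b l \<and> A l \<omega> = a l}
      = {\<omega> \<in> space M. (X l \<omega>, Y l \<omega>) \<in> S \<and> A l \<omega> = a l}"
    using sets.sets_into_space[OF E] by (auto simp: S_def)
  then have "emeasure M {\<omega> \<in> space M. (X l \<omega>, Y l \<omega>) \<in> E \<and> bin (X l \<omega>) = b l \<and> A l \<omega> = a l}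
      = ennreal (\<integral>\<omega>. indicator S (X l \<omega>, Y l \<omega>) * ?q (X l \<omega>) \<partial>M)"
    using A_law[OF l S, of "a l"] by (simp add: emeasure_eq_measure)
  also have "\<dots> = (\<integral>\<^sup>+\<omega>. ennreal (indicator S (X l \<omega>, Y l \<omega>) * ?q (X l \<omega>)) \<partial>M)"
  proof (rule nn_integral_eq_integral[symmetric])
    show "AE \<omega> in M. 0 \<le> indicator S (X l \<omega>, Y l \<omega>) * ?q (X l \<omega>)"
      using p_bounds X_in_space[OF l] by (auto simp: less_imp_le)
    show "integrable M (\<lambda>\<omega>. indicator S (X l \<omega>, Y l \<omega>) * ?q (X l \<omega>))"
    proof (rule integrable_const_bound[where B = 1])
      show "AE \<omega> in M. norm (indicator S (X l \<omega>, Y l \<omega>) * ?q (X l \<omega>)) \<le> 1"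
      proof (rule AE_I2)
        fix \<omega> assume "\<omega> \<in> space M"
        then have "0 < p (X l \<omega>)" "p (X l \<omega>) < 1"
          using p_bounds X_in_space[OF l] by auto
        then show "norm (indicator S (X l \<omega>, Y l \<omega>) * ?q (X l \<omega>)) \<le> 1"
          by (auto simp: indicator_def)
      qed
    qed measurable
  qed
  also have "\<dots> = (\<integral>\<^sup>+\<omega>. wt b a l (X l \<omega>, Y l \<omega>) * indicator E (X l \<omega>, Y l \<omega>) \<partial>M)"
    using sets.sets_into_space[OF E] by (intro nn_integral_cong) (auto simp: S_def wt_def indicator_def)
  also have "\<dots> = (\<integral>\<^sup>+z. wt b a l z * indicator E z \<partial>distr M N (\<lambda>\<omega>. (X l \<omega>, Y l \<omega>)))"
    by (subst nn_integral_distr) auto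
  also have "\<dots> = (\<integral>\<^sup>+z. wt b a l z * indicator E z \<partial>P)"
    by (simp add: iid_ident[OF l] P_def)
  finally show ?thesis .
qed

abbreviation "PP \<equiv> PiM {..<n} (\<lambda>_. P)"

lemma sets_P [measurable_cong]: "sets P = sets N"
  by (simp add: P_def)

lemma space_P: "space P = space N"
  by (simp add: P_def)

lemma sets_PP: "sets PP = sets NN"
  by (intro sets_PiM_cong refl sets_P)

lemma space_PP: "space PP = space NN"
  using sets_PP by (rule sets_eq_imp_space_eq)

lemma measurable_PP_eq: "borel_measurable PP = borel_measurable NN"
  by (rule measurable_cong_sets[OF sets_PP refl])

text \<open>Positivity of \<open>n\<close> puts index 0, whose law is \<open>P\<close>, among the
  measurable sample indices.\<close>

lemma prob_space_P: "0 < n \<Longrightarrow> prob_space P"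
  unfolding P_def using sample_measurable[of 0] by (intro prob_space_distr) measurable

text \<open>Bins and indicators are prescribed coordinate by coordinate, so together with a
  rectangle they still give an intersection of events on single coordinates, to which independence
  applies.\<close>

lemma prob_rectangle:
  assumes n: "0 < n" and E: "\<And>l. l \<in> {..<n} \<Longrightarrow> E l \<in> sets N"
  shows "emeasure M (bin_event b a \<inter> (sample -` Pi\<^sub>E {..<n} E \<inter> space M))
       = (\<Prod>l<n. \<integral>\<^sup>+z. wt b a l z * indicator (E l) z \<partial>P)"
proof -
  let ?V = "\<lambda>l \<omega>. (X l \<omega>, Y l \<omega>, A l \<omega>)"
  let ?K = "SX \<Otimes>\<^sub>M borel \<Otimes>\<^sub>M count_space UNIV"
  define F where "F l = {v \<in> space ?K. (fst v, fst (snd v)) \<in> E l \<and> bin (fst v) = b l \<and> snd (snd v) = a l}" for l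
  have F: "F l \<in> sets ?K" if "l \<in> {..<n}" for l
  proof -
    note [measurable] = E[OF that]
    show ?thesis unfolding F_def by measurable
  qed
  have V: "?V l -` F l \<inter> space M
      = {\<omega> \<in> space M. (X l \<omega>, Y l \<omega>) \<in> E l \<and> bin (X l \<omega>) = b l \<and> A l \<omega> = a l}" if "l < n" for l
    using X_in_space[OF that] by (auto simp: F_def space_pair_measure)
  \<comment> \<open>An empty intersection would be the whole type, hence the use of
    \<open>0 < n\<close>.\<close>
  have "bin_event b a \<inter> (sample -` Pi\<^sub>E {..<n} E \<inter> space M) = (\<Inter>l<n. ?V l -` F l \<inter> space M)"
    using n V by (auto simp: bin_event_def sample_def PiE_iff extensional_def Pi_iff)
  then have "emeasure M (bin_event b a \<inter> (sample -` Pi\<^sub>E {..<n} E \<inter> space M))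
      = ennreal (prob (\<Inter>l<n. ?V l -` F l \<inter> space M))"
    by (simp add: emeasure_eq_measure)
  also have "prob (\<Inter>l<n. ?V l -` F l \<inter> space M) = (\<Prod>l<n. prob (?V l -` F l \<inter> space M))"
    by (rule indep_varsD_finite[OF iid_indep]) (use n F in auto)
  also have "ennreal \<dots> = (\<Prod>l<n. emeasure M (?V l -` F l \<inter> space M))"
    by (simp add: emeasure_eq_measure prod_ennreal)
  also have "\<dots> = (\<Prod>l<n. \<integral>\<^sup>+z. wt b a l z * indicator (E l) z \<partial>P)"
  proof (rule prod.cong[OF refl])
    fix l assume l: "l \<in> {..<n}"
    show "emeasure M (?V l -` F l \<inter> space M) = (\<integral>\<^sup>+z. wt b a l z * indicator (E l) z \<partial>P)"
      using emeasure_single[OF _ E[OF l], where b = b and a = a] V[of l] l by simp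
  qed
  finally show ?thesis .
qed

text \<open>As functions of the set, both sides are measures on the product space, finite and equal
  on rectangles by \<open>prob_rectangle\<close>; such measures coincide.\<close>

lemma joint_law:
  assumes n: "0 < n" and Phi: "\<Phi> \<in> sets NN"
  shows "emeasure M (bin_event b a \<inter> (sample -` \<Phi> \<inter> space M))
       = (\<integral>\<^sup>+z. (\<Prod>l<n. wt b a l (z l)) * indicator \<Phi> z \<partial>PP)"
proof -
  interpret P: prob_space P by (rule prob_space_P[OF n])
  interpret PP: product_sigma_finite "\<lambda>_. P" by standard
  let ?W = "\<lambda>z. \<Prod>l<n. wt b a l (z l)"
  have W: "?W \<in> borel_measurable PP"
    by (simp add: measurable_PP_eq)
  define D1 where "D1 = distr (density M (indicator (bin_event b a))) NN sample"
  define D2 where "D2 = density PP ?W"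
  have D1: "emeasure D1 \<Psi> = emeasure M (bin_event b a \<inter> (sample -` \<Psi> \<inter> space M))" if "\<Psi> \<in> sets NN" for \<Psi>
  proof -
    have S: "sample -` \<Psi> \<inter> space M \<in> sets M"
      by (rule measurable_sets[OF sample_meas that])
    have "emeasure D1 \<Psi> = (\<integral>\<^sup>+\<omega>. indicator (bin_event b a) \<omega> * indicator (sample -` \<Psi> \<inter> space M) \<omega> \<partial>M)"
      unfolding D1_def using that S by (simp add: emeasure_distr emeasure_density)
    also have "\<dots> = (\<integral>\<^sup>+\<omega>. indicator (bin_event b a \<inter> (sample -` \<Psi> \<inter> space M)) \<omega> \<partial>M)"
      by (intro nn_integral_cong) (simp add: indicator_inter_arith)
    also have "\<dots> = emeasure M (bin_event b a \<inter> (sample -` \<Psi> \<inter> space M))"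
      using S by (intro nn_integral_indicator) auto
    finally show ?thesis .
  qed
  have D2: "emeasure D2 \<Psi> = (\<integral>\<^sup>+z. ?W z * indicator \<Psi> z \<partial>PP)" if "\<Psi> \<in> sets NN" for \<Psi>
    using that W unfolding D2_def by (simp add: emeasure_density sets_PP)
  have "D1 = D2"
  proof (rule measure_eqI_PiM_finite[where I = "{..<n}" and M = "\<lambda>_. N" and A = "\<lambda>_. space NN"])
    show "sets D1 = sets NN" "sets D2 = sets NN"
      by (simp_all add: D1_def D2_def sets_PP)
    fix E :: "nat \<Rightarrow> ('x \<times> real) set" assume E: "\<And>l. l \<in> {..<n} \<Longrightarrow> E l \<in> sets N"
    then have Es: "Pi\<^sub>E {..<n} E \<in> sets NN" by (intro sets_PiM_I_finite) auto
    have "emeasure D2 (Pi\<^sub>E {..<n} E) = (\<integral>\<^sup>+z. (\<Prod>l<n. wt b a l (z l) * indicator (E l) (z l)) \<partial>PP)"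
      unfolding D2[OF Es]
    proof (rule nn_integral_cong)
      fix z assume "z \<in> space PP"
      then have "z \<in> extensional {..<n}"
        by (auto simp: space_PiM PiE_iff)
      then have "indicator (Pi\<^sub>E {..<n} E) z = (\<Prod>l<n. indicator (E l) (z l) :: ennreal)"
        by (auto simp: indicator_def PiE_iff Pi_iff)
      then show "?W z * indicator (Pi\<^sub>E {..<n} E) z = (\<Prod>l<n. wt b a l (z l) * indicator (E l) (z l))"
        by (simp add: prod.distrib)
    qed
    also have "\<dots> = (\<Prod>l<n. \<integral>\<^sup>+z. wt b a l z * indicator (E l) z \<partial>P)"
    proof (rule PP.product_nn_integral_prod)
      fix l assume "l \<in> {..<n}"
      note [measurable] = E[OF this]
      show "(\<lambda>z. wt b a l z * indicator (E l) z) \<in> borel_measurable P" by measurable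
    qed simp
    also have "\<dots> = emeasure D1 (Pi\<^sub>E {..<n} E)"
      unfolding D1[OF Es] by (rule prob_rectangle[OF n E, symmetric])
    finally show "emeasure D1 (Pi\<^sub>E {..<n} E) = emeasure D2 (Pi\<^sub>E {..<n} E)" ..
  next
    show "range (\<lambda>_. space NN) \<subseteq> prod_algebra {..<n} (\<lambda>_. N)"
      by (auto simp: space_PiM intro!: prod_algebraI_finite)
    show "emeasure D1 (space NN) \<noteq> \<infinity>" for i :: nat
      by (subst D1) simp_all
  qed simp_all
  then show ?thesis
    using D1[OF Phi] D2[OF Phi] by simp
qed

text \<open>Only the factors of \<open>i\<close> and \<open>j\<close> change. If
  \<open>a i = a j\<close>, their product is merely reordered; otherwise old and new product differ
  by a ratio of odds within one bin.\<close>

lemma wt_transpose_le: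
  assumes ij: "i < n" "j < n" "b i = b j" and z: "z \<in> space PP"
  shows "(\<Prod>l<n. wt b a l (z (Transposition.transpose i j l))) \<le> ennreal (1 + eps) * (\<Prod>l<n. wt b a l (z l))"
proof (cases "i = j")
  case True
  have "ennreal 1 * (\<Prod>l<n. wt b a l (z l)) \<le> ennreal (1 + eps) * (\<Prod>l<n. wt b a l (z l))"
    using eps by (intro mult_right_mono ennreal_leI) auto
  with True show ?thesis by simp
next
  case False
  let ?R = "{..<n} - {i, j}"
  have split: "(\<Prod>l<n. f l) = f i * f j * (\<Prod>l\<in>?R. f l)" for f :: "nat \<Rightarrow> ennreal"
  proof -
    have "{..<n} = insert i (insert j ?R)" using ij by auto
    then have "(\<Prod>l<n. f l) = prod f (insert i (insert j ?R))" by simp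
    also have "\<dots> = f i * f j * (\<Prod>l\<in>?R. f l)" using False by (simp add: mult.assoc)
    finally show ?thesis .
  qed
  have rest: "(\<Prod>l\<in>?R. wt b a l (z (Transposition.transpose i j l))) = (\<Prod>l\<in>?R. wt b a l (z l))"
    by (intro prod.cong) (auto simp: Transposition.transpose_def)
  have "fst (z l) \<in> space SX" if "l < n" for l
    using z that by (auto simp: space_P space_PiM PiE_iff space_pair_measure mem_Times_iff)
  then have p: "0 < p (fst (z i))" "p (fst (z i)) < 1" "0 < p (fst (z j))" "p (fst (z j)) < 1"
    using p_bounds ij by auto
  have "wt b a i (z j) * wt b a j (z i) \<le> ennreal (1 + eps) * (wt b a i (z i) * wt b a j (z j))"
  \<comment> \<open>If either entry is outside the common bin, the left-hand product is 0, because
    \<open>b i = b j\<close>.\<close>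
  proof (cases "bin (fst (z i)) = b i \<and> bin (fst (z j)) = b i")
    case True
    define u where "u = p (fst (z i))"
    define v where "v = p (fst (z j))"
    note uv = p[folded u_def v_def]
    have "pbin eps u = pbin eps v"
      using True by (simp add: bin_def u_def v_def)
    then have odds: "(1 - v) * u \<le> (1 + eps) * ((1 - u) * v)" "(1 - u) * v \<le> (1 + eps) * ((1 - v) * u)"
      using uv eps by (auto intro: pbin_eq_imp_odds_le)
    have le: "x \<le> (1 + eps) * x" if "0 \<le> x" for x
      using eps that by (simp add: algebra_simps)
    have wt: "wt b a i (z i) = ennreal (if a i then u else 1 - u)" "wt b a i (z j) = ennreal (if a i then v else 1 - v)"
      "wt b a j (z i) = ennreal (if a j then u else 1 - u)" "wt b a j (z j) = ennreal (if a j then v else 1 - v)"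
      using True ij by (simp_all add: wt_def u_def v_def)
    have "(if a i then v else 1 - v) * (if a j then u else 1 - u)
        \<le> (1 + eps) * ((if a i then u else 1 - u) * (if a j then v else 1 - v))"
      using odds le[of "u * v"] le[of "(1 - u) * (1 - v)"] uv by (auto simp: mult.commute)
    moreover have "ennreal x * ennreal y \<le> ennreal (1 + eps) * (ennreal x' * ennreal y')"
      if "0 \<le> x" "0 \<le> y" "0 \<le> x'" "0 \<le> y'" "x * y \<le> (1 + eps) * (x' * y')" for x y x' y'
      using that eps by (simp add: ennreal_mult[symmetric] ennreal_leI del: ennreal_plus)
    ultimately show ?thesis
      unfolding wt using uv by simp
  qed (use ij in \<open>auto simp: wt_def\<close>)
  then have "wt b a i (z j) * wt b a j (z i) * (\<Prod>l\<in>?R. wt b a l (z l))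
      \<le> ennreal (1 + eps) * (wt b a i (z i) * wt b a j (z j)) * (\<Prod>l\<in>?R. wt b a l (z l))"
    by (rule mult_right_mono) simp
  then show ?thesis
    unfolding split rest by (simp add: mult.assoc)
qed

lemma prob_transpose_le:
  assumes ij: "i < n" "j < n" "b i = b j" and Phi: "\<Phi> \<in> sets NN" "\<Psi> \<in> sets NN"
    and sym: "\<And>z. z \<in> space NN \<Longrightarrow> (\<lambda>l\<in>{..<n}. z (Transposition.transpose i j l)) \<in> \<Psi> \<longleftrightarrow> z \<in> \<Phi>"
  shows "prob (bin_event b a \<inter> (sample -` \<Psi> \<inter> space M))
       \<le> (1 + eps) * prob (bin_event b a \<inter> (sample -` \<Phi> \<inter> space M))"
proof -
  have n: "0 < n" using ij by simp
  interpret P: prob_space P by (rule prob_space_P[OF n])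
  let ?t = "\<lambda>z. \<lambda>l\<in>{..<n}. z (Transposition.transpose i j l)"
  let ?W = "\<lambda>z. \<Prod>l<n. wt b a l (z l)"
  have "ennreal (prob (bin_event b a \<inter> (sample -` \<Psi> \<inter> space M))) = (\<integral>\<^sup>+z. ?W z * indicator \<Psi> z \<partial>PP)"
    using joint_law[OF n Phi(2), of b a] by (simp add: emeasure_eq_measure)
  \<comment> \<open>Invariance of \<open>PP\<close> applies the swap to the density and the event
    together; \<open>sym\<close> then turns the event into \<open>\<Phi>\<close>, and only the
    density has to be compared.\<close>
  also have "\<dots> = (\<integral>\<^sup>+z. ?W (?t z) * indicator \<Psi> (?t z) \<partial>PP)"
  proof (rule P.nn_integral_PiM_transpose)
    note [measurable] = Phi
    show "(\<lambda>z. ?W z * indicator \<Psi> z) \<in> borel_measurable PP"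
      unfolding measurable_PP_eq by measurable
  qed (use ij in auto)
  also have "\<dots> \<le> (\<integral>\<^sup>+z. ennreal (1 + eps) * (?W z * indicator \<Phi> z) \<partial>PP)"
  proof (rule nn_integral_mono)
    fix z assume z: "z \<in> space PP"
    have "?W (?t z) \<le> ennreal (1 + eps) * ?W z"
      using wt_transpose_le[OF ij z, of a] by simp
    then show "?W (?t z) * indicator \<Psi> (?t z) \<le> ennreal (1 + eps) * (?W z * indicator \<Phi> z)"
      using sym[of z] z by (auto simp: indicator_def space_PP)
  qed
  also have "\<dots> = ennreal (1 + eps) * (\<integral>\<^sup>+z. ?W z * indicator \<Phi> z \<partial>PP)"
  proof (rule nn_integral_cmult)
    note [measurable] = Phi
    show "(\<lambda>z. ?W z * indicator \<Phi> z) \<in> borel_measurable PP"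
      unfolding measurable_PP_eq by measurable
  qed
  also have "\<dots> = ennreal ((1 + eps) * prob (bin_event b a \<inter> (sample -` \<Phi> \<inter> space M)))"
    using joint_law[OF n Phi(1), of b a] eps by (simp add: emeasure_eq_measure ennreal_mult)
  finally show ?thesis
    using eps by (subst (asm) ennreal_le_iff) auto
qed

end

section \<open>The weights and the quantile of the full sample\<close>

text \<open>The weight of an observed atom, extended to missing indices. The missing indices of a
  bin \<open>k\<close> then weigh \<open>(NB0 n b a k)^2 / (N0 n a * NB n b k)\<close> together,
  which is what that bin contributes to the atom at infinity.\<close>

definition pro_weight :: "nat \<Rightarrow> (nat \<Rightarrow> int) \<Rightarrow> (nat \<Rightarrow> bool) \<Rightarrow> nat \<Rightarrow> real" where
  "pro_weight n b a j = real (NB0 n b a (b j)) / (real (N0 n a) * real (NB n b (b j)))"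

lemma pro_weight_nonneg: "0 \<le> pro_weight n b a j"
  by (simp add: pro_weight_def)

text \<open>The atom at infinity is never strictly below a real number, so it drops out of the
  sum.\<close>

lemma pro_threshold_ge_iff:
  assumes "alpha < 1"
  shows "ereal x \<le> pro_threshold alpha n b a S \<longleftrightarrow>
    (\<Sum>j | j < n \<and> a j. if S j < x then pro_weight n b a j else 0) < 1 - alpha"
proof -
  let ?w = "\<lambda>j. case j of
              Some i \<Rightarrow> real (NB0 n b a (b i)) / (real (N0 n a) * real (NB n b (b i)))
            | None \<Rightarrow> (1 / real (N0 n a)) *
                  (\<Sum>k\<in>b ` {..<n}. real (NB0 n b a k) ^ 2 / real (NB n b k))"
  let ?v = "\<lambda>j. case j of Some i \<Rightarrow> ereal (S i) | None \<Rightarrow> \<infinity>"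
  let ?J = "{j. j < n \<and> a j}"
  have "(\<Sum>j\<in>Some ` ?J \<union> {None}. if ?v j < ereal x then ?w j else 0)
      = (\<Sum>j\<in>Some ` ?J. if ?v j < ereal x then ?w j else 0)"
    by (subst sum.union_disjoint) auto
  also have "\<dots> = (\<Sum>j\<in>?J. if S j < x then pro_weight n b a j else 0)"
    by (subst sum.reindex) (auto simp: pro_weight_def intro!: sum.cong)
  finally have eq: "(\<Sum>j\<in>Some ` ?J \<union> {None}. if ?v j < ereal x then ?w j else 0)
      = (\<Sum>j\<in>?J. if S j < x then pro_weight n b a j else 0)" .
  have nonneg: "0 \<le> ?w j" for j
    by (cases j) (auto intro!: divide_nonneg_nonneg sum_nonneg)
  show ?thesis
    unfolding pro_threshold_def
    by (subst ereal_le_disc_quantile_iff[OF _ nonneg]) (use assms in \<open>simp_all only: eq, simp_all\<close>)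
qed

lemma sum_pro_weight:
  "(\<Sum>j<n. pro_weight n b a j * e j)
       = (\<Sum>i | i < n \<and> \<not> a i. (\<Sum>j | j < n \<and> b j = b i. e j) / real (NB n b (b i))) / real (N0 n a)"
proof -
  have "(\<Sum>j<n. pro_weight n b a j * e j)
      = (\<Sum>j<n. real (NB0 n b a (b j)) / real (NB n b (b j)) * e j) / real (N0 n a)"
    unfolding sum_divide_distrib by (intro sum.cong) (simp_all add: pro_weight_def)
  then show ?thesis by (simp only: sum_bin_averages)
qed

text \<open>In \<open>sum_pro_weight\<close> with \<open>e\<close> constantly 1 every bin average is
  1, since the bin of \<open>i\<close> contains \<open>i\<close> and is not empty.\<close>

lemma sum_pro_weight_eq_1:
  assumes "N0 n a \<noteq> 0"
  shows "(\<Sum>j<n. pro_weight n b a j) = 1"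
proof -
  have "(\<Sum>j | j < n \<and> b j = b i. 1) / real (NB n b (b i)) = 1" if "i < n" for i
  proof -
    have "i \<in> {j. j < n \<and> b j = b i}" using that by simp
    then have "card {j. j < n \<and> b j = b i} \<noteq> 0"
      by (subst card_0_eq) auto
    then show ?thesis by (simp add: NB_def)
  qed
  then have "(\<Sum>i | i < n \<and> \<not> a i. (\<Sum>j | j < n \<and> b j = b i. 1) / real (NB n b (b i))) = (\<Sum>i | i < n \<and> \<not> a i. 1)"
    by (intro sum.cong) auto
  also have "\<dots> = real (N0 n a)"
    by (simp add: N0_def)
  finally show ?thesis
    using sum_pro_weight[of n b a "\<lambda>_. 1"] assms by simp
qed

text \<open>This allows the random bins and indicators to be replaced by a fixed outcome, with which
  they agree only at indices below \<open>n\<close>.\<close>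

lemma pro_coverage_cong:
  assumes "\<And>i. i < n \<Longrightarrow> b i = b' i" "\<And>i. i < n \<Longrightarrow> a i = a' i"
  shows "pro_coverage alpha Ys s n b a x y = pro_coverage alpha Ys s n b' a' x y"
proof -
  have 1: "N0 n a = N0 n a'" "NB n b = NB n b'" "NB0 n b a = NB0 n b' a'" "b ` {..<n} = b' ` {..<n}"
    "{i. i < n \<and> a i} = {i. i < n \<and> a' i}" "{i. i < n \<and> \<not> a i} = {i. i < n \<and> \<not> a' i}"
    using assms by (auto simp: N0_def NB_def NB0_def fun_eq_iff intro!: arg_cong[where f = card])
  have "pro_threshold alpha n b a S = pro_threshold alpha n b' a' S" for S
    unfolding pro_threshold_def disc_quantile_def 1 using assms
    by (intro arg_cong[where f = Inf] Collect_cong arg_cong2[where f = "(\<le>)"] sum.cong refl)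
       (auto split: option.split)
  then show ?thesis unfolding pro_coverage_def 1 by simp
qed

lemma pro_coverage_bounds: "0 \<le> pro_coverage alpha Ys s n b a x y" "pro_coverage alpha Ys s n b a x y \<le> 1"
proof -
  let ?f = "\<lambda>i. if y i \<in> Ys \<and> ereal (s (x i) (y i)) \<le> pro_threshold alpha n b a (\<lambda>j. s (x j) (y j)) then 1 else 0 :: real"
  have "(\<Sum>i | i < n \<and> \<not> a i. ?f i) \<le> (\<Sum>i | i < n \<and> \<not> a i. 1)"
    by (rule sum_mono) auto
  also have "\<dots> = real (N0 n a)" by (simp add: N0_def)
  finally show "pro_coverage alpha Ys s n b a x y \<le> 1"
    by (simp add: pro_coverage_def divide_le_eq)
  show "0 \<le> pro_coverage alpha Ys s n b a x y"
    by (auto simp: pro_coverage_def intro!: divide_nonneg_nonneg sum_nonneg)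
qed

text \<open>\<open>full_covers\<close> says that \<open>S i\<close> is at most the quantile of the weighted full sample (unobserved
  scores included), written without the quantile so that measurability in \<open>S\<close> is immediate.\<close>

definition full_covers ::
  "real \<Rightarrow> nat \<Rightarrow> (nat \<Rightarrow> int) \<Rightarrow> (nat \<Rightarrow> bool) \<Rightarrow> (nat \<Rightarrow> real) \<Rightarrow> nat \<Rightarrow> bool" where
  "full_covers alpha n b a S i \<longleftrightarrow> (\<Sum>j<n. if S j < S i then pro_weight n b a j else 0) < 1 - alpha"

text \<open>Restricting the sum to observed indices drops nonnegative terms; this is the effect of
  moving the missing mass to infinity.\<close>

lemma full_covers_imp_le_threshold:
  assumes "alpha < 1" "full_covers alpha n b a S i"
  shows "ereal (S i) \<le> pro_threshold alpha n b a S"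
proof -
  have "(\<Sum>j | j < n \<and> a j. if S j < S i then pro_weight n b a j else 0)
      \<le> (\<Sum>j<n. if S j < S i then pro_weight n b a j else 0)"
    by (intro sum_mono2) (auto simp: pro_weight_nonneg)
  then show ?thesis
    using assms by (simp add: pro_threshold_ge_iff full_covers_def)
qed

lemma full_covers_weight_ge:
  assumes "N0 n a \<noteq> 0" "0 < alpha"
  shows "1 - alpha \<le> (\<Sum>j<n. pro_weight n b a j * of_bool (full_covers alpha n b a S j))"
proof -
  have "1 - alpha \<le> (\<Sum>j<n. if full_covers alpha n b a S j then pro_weight n b a j else 0)"
    unfolding full_covers_def
    by (rule sum_weights_below_quantile) (use assms in \<open>auto simp: pro_weight_nonneg sum_pro_weight_eq_1\<close>)
  also have "\<dots> = (\<Sum>j<n. pro_weight n b a j * of_bool (full_covers alpha n b a S j))"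
    by (intro sum.cong) auto
  finally show ?thesis .
qed

text \<open>The weights are constant on bins, so the swap permutes the terms of the sum and carries
  the score of \<open>i\<close> to position \<open>j\<close>.\<close>

lemma full_covers_transpose:
  assumes "i < n" "j < n" "b i = b j"
  shows "full_covers alpha n b a (\<lambda>l. S (Transposition.transpose i j l)) j \<longleftrightarrow> full_covers alpha n b a S i"
proof -
  let ?t = "Transposition.transpose i j"
  have w: "pro_weight n b a (?t l) = pro_weight n b a l" for l
    using assms by (auto simp: pro_weight_def Transposition.transpose_def)
  have bij: "bij_betw ?t {..<n} {..<n}"
    by (rule bij_betw_byWitness[where f' = ?t]) (use assms in \<open>auto simp: Transposition.transpose_def\<close>)
  have "(\<Sum>l<n. if S (?t l) < S (?t j) then pro_weight n b a l else 0)
      = (\<Sum>l<n. if S (?t l) < S i then pro_weight n b a (?t l) else 0)"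
    by (simp add: w cong: if_cong)
  also have "\<dots> = (\<Sum>l<n. if S l < S i then pro_weight n b a l else 0)"
    using bij by (rule sum.reindex_bij_betw)
  finally show ?thesis by (simp add: full_covers_def)
qed

section \<open>Measurability, and coverage on an event of fixed bins and indicators\<close>

context mar_sample begin

lemma full_covers_set:
  assumes s: "(\<lambda>(x, y). s x y) \<in> borel_measurable N" and i: "i < n"
  shows "{z \<in> space NN. full_covers alpha n b a (\<lambda>l. s (fst (z l)) (snd (z l))) i} \<in> sets NN"
proof -
  have comp: "(\<lambda>z. s (fst (z l)) (snd (z l))) \<in> borel_measurable NN" if "l < n" for l
    using measurable_compose[OF measurable_component_singleton[of l "{..<n}" "\<lambda>_. N"] s] that
    by (simp add: case_prod_beta)
  note [measurable] = comp[OF i]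
  have "(\<lambda>z. \<Sum>j<n. if s (fst (z j)) (snd (z j)) < s (fst (z i)) (snd (z i)) then pro_weight n b a j else 0)
      \<in> borel_measurable NN"
  proof (rule borel_measurable_sum)
    fix j assume "j \<in> {..<n}"
    then have [measurable]: "(\<lambda>z. s (fst (z j)) (snd (z j))) \<in> borel_measurable NN"
      using comp by simp
    show "(\<lambda>z. if s (fst (z j)) (snd (z j)) < s (fst (z i)) (snd (z i)) then pro_weight n b a j else 0)
      \<in> borel_measurable NN" by measurable
  qed
  then show ?thesis unfolding full_covers_def by measurable
qed

text \<open>With \<open>b\<close> and \<open>a\<close> fixed, \<open>pro_threshold_ge_iff\<close>
  turns the comparison with an infimum into one with a finite sum of measurable functions.
  \<open>Y_in\<close> removes the test for membership in \<open>Ys\<close>, a set not assumed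
  measurable.\<close>

lemma pro_coverage_measurable_fixed:
  assumes s: "(\<lambda>(x, y). s x y) \<in> borel_measurable N" and "alpha < 1"
    and Y_in: "\<And>i \<omega>. \<omega> \<in> space M \<Longrightarrow> Y i \<omega> \<in> Ys"
  shows "(\<lambda>\<omega>. pro_coverage alpha Ys s n b a (\<lambda>i. X i \<omega>) (\<lambda>i. Y i \<omega>)) \<in> borel_measurable M"
proof -
  have score: "(\<lambda>\<omega>. s (X l \<omega>) (Y l \<omega>)) \<in> borel_measurable M" if "l < n" for l
  proof -
    note [measurable] = sample_measurable[OF that]
    have "(\<lambda>\<omega>. (X l \<omega>, Y l \<omega>)) \<in> measurable M N" by measurable
    from measurable_compose[OF this s] show ?thesis by simp
  qed
  have "(\<lambda>\<omega>. \<Sum>i | i < n \<and> \<not> a i. if (\<Sum>j | j < n \<and> a j. if s (X j \<omega>) (Y j \<omega>) < s (X i \<omega>) (Y i \<omega>)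
          then pro_weight n b a j else 0) < 1 - alpha then 1 else 0 :: real) \<in> borel_measurable M"
  proof (rule borel_measurable_sum)
    fix i assume "i \<in> {i. i < n \<and> \<not> a i}"
    then have [measurable]: "(\<lambda>\<omega>. s (X i \<omega>) (Y i \<omega>)) \<in> borel_measurable M" using score by simp
    have [measurable]: "(\<lambda>\<omega>. \<Sum>j | j < n \<and> a j. if s (X j \<omega>) (Y j \<omega>) < s (X i \<omega>) (Y i \<omega>)
          then pro_weight n b a j else 0) \<in> borel_measurable M"
    proof (rule borel_measurable_sum)
      fix j assume "j \<in> {j. j < n \<and> a j}"
      then have [measurable]: "(\<lambda>\<omega>. s (X j \<omega>) (Y j \<omega>)) \<in> borel_measurable M" using score by simp
      show "(\<lambda>\<omega>. if s (X j \<omega>) (Y j \<omega>) < s (X i \<omega>) (Y i \<omega>) then pro_weight n b a j else 0) \<in> borel_measurable M"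
        by measurable
    qed
    show "(\<lambda>\<omega>. if (\<Sum>j | j < n \<and> a j. if s (X j \<omega>) (Y j \<omega>) < s (X i \<omega>) (Y i \<omega>)
          then pro_weight n b a j else 0) < 1 - alpha then 1 else 0 :: real) \<in> borel_measurable M"
      by measurable
  qed
  then have [measurable]: "(\<lambda>\<omega>. \<Sum>i | i < n \<and> \<not> a i. if ereal (s (X i \<omega>) (Y i \<omega>))
        \<le> pro_threshold alpha n b a (\<lambda>j. s (X j \<omega>) (Y j \<omega>)) then 1 else 0 :: real) \<in> borel_measurable M"
    by (simp add: pro_threshold_ge_iff[OF \<open>alpha < 1\<close>])
  have "(\<lambda>\<omega>. if N0 n a = 0 then 1 else (1 / real (N0 n a)) * (\<Sum>i | i < n \<and> \<not> a i. if ereal (s (X i \<omega>) (Y i \<omega>))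
        \<le> pro_threshold alpha n b a (\<lambda>j. s (X j \<omega>) (Y j \<omega>)) then 1 else 0 :: real)) \<in> borel_measurable M"
    by measurable
  then show ?thesis
    by (rule measurable_cong[THEN iffD1, rotated]) (simp add: pro_coverage_def Y_in)
qed

text \<open>A list rather than a pair of functions, so that the values lie in a countable
  type.\<close>

definition "bins_obs \<omega> = map (\<lambda>i. (bin (X i \<omega>), A i \<omega>)) [0..<n]"

lemma bins_obs_eq_iff:
  "{\<omega> \<in> space M. bins_obs \<omega> = t} = (if length t = n then bin_event (\<lambda>i. fst (t ! i)) (\<lambda>i. snd (t ! i)) else {})"
  by (auto simp: bins_obs_def bin_event_def list_eq_iff_nth_eq prod_eq_iff)

lemma bins_obs_measurable [measurable]: "bins_obs \<in> measurable M (count_space UNIV)"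
proof (subst measurable_count_space_eq2_countable)
  have "bins_obs -` {t} \<inter> space M = {\<omega> \<in> space M. bins_obs \<omega> = t}" for t
    by auto
  then show "bins_obs \<in> space M \<rightarrow> UNIV \<and> (\<forall>t\<in>UNIV. bins_obs -` {t} \<inter> space M \<in> sets M)"
    by (auto simp: bins_obs_eq_iff)
qed

text \<open>The functions for fixed outcomes are glued along the countably many values of
  \<open>bins_obs\<close>.\<close>

lemma pro_coverage_measurable:
  assumes "(\<lambda>(x, y). s x y) \<in> borel_measurable N" "alpha < 1" "\<And>i \<omega>. \<omega> \<in> space M \<Longrightarrow> Y i \<omega> \<in> Ys"
  shows "(\<lambda>\<omega>. pro_coverage alpha Ys s n (\<lambda>i. bin (X i \<omega>)) (\<lambda>i. A i \<omega>) (\<lambda>i. X i \<omega>) (\<lambda>i. Y i \<omega>))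
    \<in> borel_measurable M"
proof -
  define g where "g t \<omega> = pro_coverage alpha Ys s n (\<lambda>i. fst (t ! i)) (\<lambda>i. snd (t ! i)) (\<lambda>i. X i \<omega>) (\<lambda>i. Y i \<omega>)"
    for t :: "(int \<times> bool) list" and \<omega>
  have "g t \<in> borel_measurable M" for t
    unfolding g_def[abs_def] by (rule pro_coverage_measurable_fixed[OF assms])
  then have "(\<lambda>\<omega>. g (bins_obs \<omega>) \<omega>) \<in> borel_measurable M"
    by (rule measurable_compose_countable[OF _ bins_obs_measurable])
  moreover have "g (bins_obs \<omega>) \<omega>
      = pro_coverage alpha Ys s n (\<lambda>i. bin (X i \<omega>)) (\<lambda>i. A i \<omega>) (\<lambda>i. X i \<omega>) (\<lambda>i. Y i \<omega>)" for \<omega>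
    unfolding g_def by (rule pro_coverage_cong) (simp_all add: bins_obs_def)
  ultimately show ?thesis by simp
qed

lemma coverage_on_bin_event:
  assumes s: "(\<lambda>(x, y). s x y) \<in> borel_measurable N" and alpha: "0 < alpha" "alpha < 1"
    and Y_in: "\<And>i \<omega>. \<omega> \<in> space M \<Longrightarrow> Y i \<omega> \<in> Ys"
  shows "(1 - alpha - eps) * prob (bin_event b a)
    \<le> (\<integral>\<omega>. indicator (bin_event b a) \<omega> *
          pro_coverage alpha Ys s n (\<lambda>i. bin (X i \<omega>)) (\<lambda>i. A i \<omega>) (\<lambda>i. X i \<omega>) (\<lambda>i. Y i \<omega>) \<partial>M)"
    (is "_ \<le> (\<integral>\<omega>. _ * ?f \<omega> \<partial>M)")
proof -
  let ?E = "bin_event b a"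
  have [measurable]: "?f \<in> borel_measurable M"
    by (rule pro_coverage_measurable[OF s alpha(2) Y_in])
  have int: "integrable M (\<lambda>\<omega>. indicator ?E \<omega> * ?f \<omega>)"
    by (rule integrable_const_bound[where B = 1])
       (auto simp: indicator_def pro_coverage_bounds intro!: AE_I2)
  have f_eq: "?f \<omega> = pro_coverage alpha Ys s n b a (\<lambda>i. X i \<omega>) (\<lambda>i. Y i \<omega>)" if "\<omega> \<in> ?E" for \<omega>
    by (rule pro_coverage_cong) (use that in \<open>simp_all add: bin_event_def\<close>)
  show ?thesis
  proof (cases "N0 n a = 0")
    \<comment> \<open>With no missing index the coverage is 1 by convention. This case includes
      \<open>n = 0\<close>.\<close>
    case True
    have "(1 - alpha - eps) * prob ?E \<le> 1 * prob ?E"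
      using alpha eps by (intro mult_right_mono) auto
    also have "\<dots> = (\<integral>\<omega>. indicator ?E \<omega> \<partial>M)"
      by (simp add: Int_absorb2 sets.sets_into_space)
    also have "\<dots> = (\<integral>\<omega>. indicator ?E \<omega> * ?f \<omega> \<partial>M)"
      using f_eq True by (intro Bochner_Integration.integral_cong) (auto simp: indicator_def pro_coverage_def)
    finally show ?thesis .
  next
    case False
    let ?I = "{i. i < n \<and> \<not> a i}"
    \<comment> \<open>\<open>C i\<close> lives in the space of samples, where the swap acts;
      \<open>e i\<close> is the joint, not the conditional, probability of \<open>?E\<close> and
      coverage of \<open>i\<close>.\<close>
    define C where "C i = {z \<in> space NN. full_covers alpha n b a (\<lambda>l. s (fst (z l)) (snd (z l))) i}" for i
    define G where "G i = ?E \<inter> (sample -` C i \<inter> space M)" for i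
    define e where "e i = prob (G i)" for i
    have C: "C i \<in> sets NN" if "i < n" for i
      unfolding C_def using s that by (rule full_covers_set)
    have G_sets: "G i \<in> sets M" if "i < n" for i
      unfolding G_def using measurable_sets[OF sample_meas C[OF that]] by auto
    have int_G: "integrable M (\<lambda>\<omega>. indicator (G i) \<omega> :: real)" "(\<integral>\<omega>. indicator (G i) \<omega> \<partial>M) = e i" if "i < n" for i
      using G_sets[OF that] by (auto simp: e_def Int_absorb2 sets.sets_into_space less_top[symmetric])
    have in_G: "\<omega> \<in> G i \<longleftrightarrow> full_covers alpha n b a (\<lambda>l. s (X l \<omega>) (Y l \<omega>)) i"
      if "\<omega> \<in> ?E" "i < n" for \<omega> i
    proof -
      have w: "\<omega> \<in> space M" using that by (simp add: bin_event_def)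
      have "full_covers alpha n b a (\<lambda>l. s (fst (sample \<omega> l)) (snd (sample \<omega> l))) i
          \<longleftrightarrow> full_covers alpha n b a (\<lambda>l. s (X l \<omega>) (Y l \<omega>)) i"
        using that(2) unfolding full_covers_def sample_def
        by (intro arg_cong2[where f = "(<)"] sum.cong) auto
      then show ?thesis
        using that w measurable_space[OF sample_meas w] by (simp add: G_def C_def)
    qed
    have swap: "e j \<le> (1 + eps) * e i" if "i < n" "j < n" "b j = b i" for i j
      unfolding e_def G_def
    proof (rule prob_transpose_le)
      fix z assume "z \<in> space NN"
      let ?tz = "\<lambda>l\<in>{..<n}. z (Transposition.transpose i j l)"
      have tin: "Transposition.transpose i j l < n" if "l < n" for l
        using that \<open>i < n\<close> \<open>j < n\<close> by (auto simp: Transposition.transpose_def)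
      then have "?tz \<in> space NN"
        using \<open>z \<in> space NN\<close> by (auto simp: space_PiM PiE_iff)
      moreover have "full_covers alpha n b a (\<lambda>l. s (fst (?tz l)) (snd (?tz l))) j \<longleftrightarrow>
        full_covers alpha n b a (\<lambda>l. (\<lambda>l. s (fst (z l)) (snd (z l))) (Transposition.transpose i j l)) j"
        using \<open>j < n\<close> unfolding full_covers_def
        by (intro arg_cong2[where f = "(<)"] sum.cong) auto
      moreover note full_covers_transpose[of i n j b alpha a "\<lambda>l. s (fst (z l)) (snd (z l))"]
      ultimately show "?tz \<in> C j \<longleftrightarrow> z \<in> C i"
        using that \<open>z \<in> space NN\<close> by (simp add: C_def)
    qed (use that C in auto)
    \<comment> \<open>On \<open>?E\<close> the integrands are compared by the deterministic bound
      \<open>full_covers_weight_ge\<close>; outside it the left one is 0.\<close>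
    have "(1 - alpha) * prob ?E = (\<integral>\<omega>. (1 - alpha) * indicator ?E \<omega> \<partial>M)"
      by (simp add: Int_absorb2 sets.sets_into_space)
    also have "\<dots> \<le> (\<integral>\<omega>. (\<Sum>j<n. pro_weight n b a j * indicator (G j) \<omega>) \<partial>M)"
    proof (rule integral_mono)
      show "integrable M (\<lambda>\<omega>. \<Sum>j<n. pro_weight n b a j * indicator (G j) \<omega>)"
        using int_G by (intro Bochner_Integration.integrable_sum integrable_mult_right) auto
      show "integrable M (\<lambda>\<omega>. (1 - alpha) * indicator ?E \<omega>)"
        by (intro integrable_mult_right) (simp add: less_top[symmetric])
      fix \<omega> assume "\<omega> \<in> space M"
      show "(1 - alpha) * indicator ?E \<omega> \<le> (\<Sum>j<n. pro_weight n b a j * indicator (G j) \<omega>)"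
      proof (cases "\<omega> \<in> ?E")
        case True
        then have "(\<Sum>j<n. pro_weight n b a j * indicator (G j) \<omega>)
            = (\<Sum>j<n. pro_weight n b a j * of_bool (full_covers alpha n b a (\<lambda>l. s (X l \<omega>) (Y l \<omega>)) j))"
          using in_G by (intro sum.cong) (auto simp: indicator_def)
        then show ?thesis
          using full_covers_weight_ge[OF False alpha(1)] True by simp
      qed (auto simp: pro_weight_nonneg intro!: sum_nonneg)
    qed
    also have "\<dots> = (\<Sum>j<n. pro_weight n b a j * e j)"
      using int_G by (subst Bochner_Integration.integral_sum) (auto intro!: sum.cong)
    also have "\<dots> = (\<Sum>i\<in>?I. (\<Sum>j | j < n \<and> b j = b i. e j) / real (NB n b (b i))) / real (N0 n a)"
      by (rule sum_pro_weight)
    \<comment> \<open>Every \<open>e j\<close> in the bin of \<open>i\<close> is at most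
      \<open>(1 + eps) * e i\<close> by \<open>swap\<close>, hence so is their average.\<close>
    also have "\<dots> \<le> (\<Sum>i\<in>?I. (1 + eps) * e i) / real (N0 n a)"
    proof (intro divide_right_mono sum_mono)
      fix i assume i: "i \<in> ?I"
      have "(\<Sum>j | j < n \<and> b j = b i. e j) \<le> (\<Sum>j | j < n \<and> b j = b i. (1 + eps) * e i)"
        using swap i by (intro sum_mono) auto
      also have "\<dots> = real (NB n b (b i)) * ((1 + eps) * e i)"
        by (simp add: NB_def)
      finally show "(\<Sum>j | j < n \<and> b j = b i. e j) / real (NB n b (b i)) \<le> (1 + eps) * e i"
        using eps by (cases "NB n b (b i) = 0") (auto simp: divide_le_eq e_def mult.commute)
    qed simp
    also have "\<dots> = (1 + eps) * ((1 / real (N0 n a)) * (\<Sum>i\<in>?I. e i))"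
      by (simp add: sum_distrib_left[symmetric])
    also have "(1 / real (N0 n a)) * (\<Sum>i\<in>?I. e i)
        = (\<integral>\<omega>. (1 / real (N0 n a)) * (\<Sum>i\<in>?I. indicator (G i) \<omega>) \<partial>M)"
      using int_G by (subst integral_mult_right_zero, subst Bochner_Integration.integral_sum) (auto intro!: sum.cong)
    \<comment> \<open>Return from the full-sample quantile to the actual threshold, which covers at
      least as many missing indices.\<close>
    also have "(1 + eps) * \<dots> \<le> (1 + eps) * (\<integral>\<omega>. indicator ?E \<omega> * ?f \<omega> \<partial>M)"
    proof (intro mult_left_mono integral_mono int)
      show "integrable M (\<lambda>\<omega>. (1 / real (N0 n a)) * (\<Sum>i\<in>?I. indicator (G i) \<omega>))"
        using int_G by (intro Bochner_Integration.integrable_sum integrable_mult_right) auto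
      fix \<omega> assume w: "\<omega> \<in> space M"
      show "(1 / real (N0 n a)) * (\<Sum>i\<in>?I. indicator (G i) \<omega>) \<le> indicator ?E \<omega> * ?f \<omega>"
      proof (cases "\<omega> \<in> ?E")
        case True
        let ?S = "\<lambda>l. s (X l \<omega>) (Y l \<omega>)"
        have "(\<Sum>i\<in>?I. indicator (G i) \<omega>)
            \<le> (\<Sum>i\<in>?I. if Y i \<omega> \<in> Ys \<and> ereal (?S i) \<le> pro_threshold alpha n b a ?S then 1 else 0 :: real)"
          using in_G[OF True] full_covers_imp_le_threshold[OF alpha(2), of n b a ?S] Y_in[OF w]
          by (intro sum_mono) (auto simp: indicator_def)
        then have "(1 / real (N0 n a)) * (\<Sum>i\<in>?I. indicator (G i) \<omega>) \<le> pro_coverage alpha Ys s n b a (\<lambda>i. X i \<omega>) (\<lambda>i. Y i \<omega>)"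
          unfolding pro_coverage_def using False by (simp add: divide_right_mono)
        then show ?thesis using True f_eq by simp
      qed (auto simp: G_def)
    qed (use eps in simp)
    finally have "(1 - alpha) * prob ?E \<le> (1 + eps) * (\<integral>\<omega>. indicator ?E \<omega> * ?f \<omega> \<partial>M)" .
    \<comment> \<open>The difference of the two sides is \<open>eps * (alpha + eps)\<close>.\<close>
    moreover have "(1 - alpha - eps) * (1 + eps) \<le> 1 - alpha"
      using alpha eps by (simp add: algebra_simps)
    then have "(1 - alpha - eps) * (1 + eps) * prob ?E \<le> (1 - alpha) * prob ?E"
      by (intro mult_right_mono) auto
    ultimately have "(1 + eps) * ((1 - alpha - eps) * prob ?E) \<le> (1 + eps) * (\<integral>\<omega>. indicator ?E \<omega> * ?f \<omega> \<partial>M)"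
      by (simp add: mult_ac)
    then show ?thesis using eps by simp
  qed
qed

end

section \<open>Conditional coverage given the bins and indicators\<close>

theorem theorem2:
  fixes M :: "'w measure" and SX :: "'x measure"
    and X :: "nat \<Rightarrow> 'w \<Rightarrow> 'x" and Y :: "nat \<Rightarrow> 'w \<Rightarrow> real" and A :: "nat \<Rightarrow> 'w \<Rightarrow> bool"
    and Ys :: "real set" and p :: "'x \<Rightarrow> real" and s :: "'x \<Rightarrow> real \<Rightarrow> real"
    and n :: nat and eps alpha :: real
  assumes M: "prob_space M"
    and Y_in: "\<And>i \<omega>. \<omega> \<in> space M \<Longrightarrow> Y i \<omega> \<in> Ys"
    and iid_indep: "prob_space.indep_vars M (\<lambda>_. SX \<Otimes>\<^sub>M borel \<Otimes>\<^sub>M count_space UNIV)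
                     (\<lambda>i \<omega>. (X i \<omega>, Y i \<omega>, A i \<omega>)) {..<n}"
    and iid_ident: "\<And>i. i < n \<Longrightarrow>
          distr M (SX \<Otimes>\<^sub>M borel) (\<lambda>\<omega>. (X i \<omega>, Y i \<omega>)) = distr M (SX \<Otimes>\<^sub>M borel) (\<lambda>\<omega>. (X 0 \<omega>, Y 0 \<omega>))"
    and A_law: "\<And>i S a. i < n \<Longrightarrow> S \<in> sets (SX \<Otimes>\<^sub>M borel) \<Longrightarrow>
          measure M {\<omega> \<in> space M. (X i \<omega>, Y i \<omega>) \<in> S \<and> A i \<omega> = a}
          = (\<integral>\<omega>. indicator S (X i \<omega>, Y i \<omega>) * (if a then p (X i \<omega>) else 1 - p (X i \<omega>)) \<partial>M)"
    and p_meas: "p \<in> borel_measurable SX"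
    and p_bounds: "\<And>x. x \<in> space SX \<Longrightarrow> 0 < p x \<and> p x < 1"
    and s_meas: "(\<lambda>(x, y). s x y) \<in> borel_measurable (SX \<Otimes>\<^sub>M borel)"
    and eps: "0 < eps"
    and alpha: "0 < alpha" "alpha < 1"
  shows "AE \<omega> in M.
           1 - alpha - eps \<le>
           real_cond_exp M
             (vimage_algebra (space M)
                (\<lambda>\<omega>. map (\<lambda>i. (pbin eps (p (X i \<omega>)), A i \<omega>)) [0..<n]) (count_space UNIV))
             (\<lambda>\<omega>. pro_coverage alpha Ys s n (\<lambda>i. pbin eps (p (X i \<omega>))) (\<lambda>i. A i \<omega>)
                      (\<lambda>i. X i \<omega>) (\<lambda>i. Y i \<omega>)) \<omega>"
proof -
  interpret prob_space M by (rule M)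
  interpret mar_sample M SX X Y A p n eps
    by (intro mar_sample.intro mar_sample_axioms.intro M iid_indep iid_ident A_law p_meas p_bounds eps)
  let ?f = "\<lambda>\<omega>. pro_coverage alpha Ys s n (\<lambda>i. bin (X i \<omega>)) (\<lambda>i. A i \<omega>) (\<lambda>i. X i \<omega>) (\<lambda>i. Y i \<omega>)"
  have [measurable]: "?f \<in> borel_measurable M"
    by (rule pro_coverage_measurable[OF s_meas alpha(2) Y_in])
  have "AE \<omega> in M. 1 - alpha - eps \<le> real_cond_exp M (vimage_algebra (space M) bins_obs (count_space UNIV)) ?f \<omega>"
  proof (rule real_cond_exp_discrete_ge)
    show "integrable M ?f"
      by (rule integrable_const_bound[where B = 1]) (auto simp: pro_coverage_bounds)
    \<comment> \<open>A list of length \<open>n\<close> gives a \<open>bin_event\<close>; for any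
      other length the level set is empty and both sides are 0.\<close>
    show "(1 - alpha - eps) * prob {\<omega> \<in> space M. bins_obs \<omega> = t}
        \<le> (\<integral>\<omega>. indicator {\<omega> \<in> space M. bins_obs \<omega> = t} \<omega> * ?f \<omega> \<partial>M)" for t
      unfolding bins_obs_eq_iff using coverage_on_bin_event[OF s_meas alpha Y_in] by simp
  qed simp
  then show ?thesis
    unfolding bins_obs_def[abs_def] bin_def .
qed

end
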